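(* Assume (A1), (A2), (A3) and that $C_1$ takes its values in $L_2(\Xi;H)$ (see the context). A necessary condition for the approximate controllability of $$dX_t^{x,u}=(AX_t^{x,u}+Bu_t)\,dt+CX_t^{x,u}\,dW_t,\quad t\ge0,\qquad X_0=x\in H,$$ is that, for every $y\in D(A^* )$ and every $\alpha<0$, $$|B^*y|+|(A^*-\alpha I)y|>0\quad\text{whenever } y\neq0.$$
   Context: $H,U,\Xi$ are separable real Hilbert spaces; $\mathcal L(\Xi,H)$ is the space of bounded linear operators, $L_2(\Xi,H)=L_2(\Xi;H)$ the space of Hilbert–Schmidt operators. $A:D(A)\subset H\to H$ is a linear dissipative operator generating a $C_0$-semigroup $(e^{tA})_{t\ge0}$. $B\in\mathcal L(U,H)$. $C$ is a linear (possibly unbounded) operator from $H$ to $\mathcal L(\Xi,H)$; products such as $e^{tA}C$ or $Ce^{tA}$ that are said to be bounded are identified with the corresponding bounded operators on all of $H$. For all $t>0$, $e^{tA}C\in\mathcal L(H;L_2(\Xi,H))$ and $|e^{tA}C|_{\mathcal L(H;L_2(\Xi,H))}\le Lt^{-\gamma}$ for some $\gamma\in[0,\frac12)$, $L>0$; and for all $t>0$, $Ce^{tA}$ maps $H$ into $L_2(\Xi;H)$. $(\Omega,\mathcal F,P)$ is a complete probability space endowed with a filtration $(\mathcal F_t)_{t\ge0}$ satisfying the usual assumptions of completeness and right-continuity, and $W$ is a cylindrical $(\mathcal F_t)$-Wiener process with values in $\Xi$. $\mathcal U$ is the set of $(\mathcal F_t)$-progressively measurable processes $u:\mathbb R_+\times\Omega\to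 U$ with $E[\int_0^T|u_t|^2dt]<\infty$ for all $T>0$. Assumption (A1): $C=C_1+C_2$ with $C_1,C_2$ linear such that 1) $C_2$ is a bounded operator from $H$ to $L_2(\Xi;H)$; 2) for all $t>0$, $C_1e^{tA}\in\mathcal L(H;L_2(\Xi;H))$, and there exist $\gamma\in[0,\frac12)$ and $L>0$ with $|C_1e^{tA}|_{\mathcal L(H;L_2(\Xi;H))}\le Lt^{-\gamma}$ for all $t>0$; 3) there exists $a>\frac12$ such that $A+a(C_1e^{\delta A})^*(C_1e^{\delta A})$ is dissipative for some sequence $\delta\searrow0$. Assumption (A2): if $C_1\neq0$, then $-A^2$ is dissipative. Assumption (A3): $A$ generates an exponentially stable, strongly continuous semigroup of operators. For $u\in\mathcal U$, the mild solution of the controlled equation is the unique progressively measurable process $X^{x,u}$ with $E[\sup_{s\in[0,T]}|X_s^{x,u}|^2]<\infty$ for all $T>0$ and $X_t=e^{tA}x+\int_0^te^{(t-s)A}Bu_s\,ds+\int_0^te^{(t-s)A}CX_s\,dW_s$ $P$-a.s. for all $t>0$. The equation is approximately controllable if for every $x\in H$, $T>0$, $\xi\in L^2(\Omega,\mathcal F_T,P;H)$ and $\varepsilon>0$ there is $u\in\mathcal U$ with $E[|X_T^{x,u}-\xi|^2]\le\varepsilon$. *)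

theory Defs
  imports "HOL-Probability.Probability"
begin

section \<open>Separable Hilbert spaces and orthonormal bases\<close>

class separable_hilbert_space = real_inner + banach + second_countable_topology

definition orthonormal :: "'a::real_inner set \<Rightarrow> bool" where
  "orthonormal E \<longleftrightarrow> pairwise orthogonal E \<and> (\<forall>e\<in>E. norm e = 1)"

definition orthonormal_basis :: "'a::real_inner set \<Rightarrow> bool" where
  "orthonormal_basis E \<longleftrightarrow> orthonormal E \<and> closure (span E) = UNIV"

lemma orthonormal_inner:
  assumes "orthonormal E" "e \<in> E" "f \<in> E"
  shows "e \<bullet> f = (if e = f then 1 else 0)"
  using assms by (auto simp: orthonormal_def pairwise_def orthogonal_def norm_eq_1)

definition gram_schmidt_residual :: "'a::real_inner set \<Rightarrow> 'a \<Rightarrow> 'a" where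
  "gram_schmidt_residual E x = x - (\<Sum>e\<in>E. (x \<bullet> e) *\<^sub>R e)"

lemma gram_schmidt_residual_orthogonal:
  assumes "orthonormal E" "finite E" "e \<in> E"
  shows "e \<bullet> gram_schmidt_residual E x = 0"
proof -
  have "(\<Sum>f\<in>E. (x \<bullet> f) * (e \<bullet> f)) = (\<Sum>f\<in>E. if e = f then x \<bullet> f else 0)"
    using assms by (intro sum.cong) (auto simp: orthonormal_inner)
  also have "\<dots> = x \<bullet> e"
    using assms by simp
  finally show ?thesis
    by (simp add: gram_schmidt_residual_def inner_diff_right inner_sum_right inner_commute)
qed

definition gram_schmidt_step :: "'a::real_inner set \<Rightarrow> 'a \<Rightarrow> 'a set" where
  "gram_schmidt_step E x =
     (let r = gram_schmidt_residual E x in if r = 0 then E else insert (r /\<^sub>R norm r) E)"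

lemma gram_schmidt_step:
  assumes "orthonormal E" "finite E"
  shows "orthonormal (gram_schmidt_step E x)" "finite (gram_schmidt_step E x)"
    "E \<subseteq> gram_schmidt_step E x" "x \<in> span (gram_schmidt_step E x)"
proof -
  define r where "r = gram_schmidt_residual E x"
  have orth: "e \<bullet> r = 0" if "e \<in> E" for e
    using gram_schmidt_residual_orthogonal[OF assms that] by (simp add: r_def)
  show "orthonormal (gram_schmidt_step E x)"
    using assms orth
    by (auto simp: gram_schmidt_step_def Let_def r_def[symmetric] orthonormal_def
        pairwise_insert orthogonal_def inner_commute)
  show "finite (gram_schmidt_step E x)" "E \<subseteq> gram_schmidt_step E x"
    using assms by (auto simp: gram_schmidt_step_def Let_def)
  have x: "x = r + (\<Sum>e\<in>E. (x \<bullet> e) *\<^sub>R e)"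
    by (simp add: r_def gram_schmidt_residual_def)
  have "r \<in> span (gram_schmidt_step E x)"
  proof (cases "r = 0")
    case False
    then have "r /\<^sub>R norm r \<in> span (gram_schmidt_step E x)"
      by (auto simp: gram_schmidt_step_def Let_def r_def[symmetric] intro: span_base)
    then have "norm r *\<^sub>R (r /\<^sub>R norm r) \<in> span (gram_schmidt_step E x)"
      by (rule span_scale)
    then show ?thesis using False by simp
  qed (simp add: span_zero)
  moreover have "(\<Sum>e\<in>E. (x \<bullet> e) *\<^sub>R e) \<in> span (gram_schmidt_step E x)"
    using \<open>E \<subseteq> gram_schmidt_step E x\<close> by (intro span_sum span_scale span_base) auto
  ultimately show "x \<in> span (gram_schmidt_step E x)"
    by (subst x) (rule span_add)
qed

primrec gram_schmidt_seq :: "(nat \<Rightarrow> 'a::real_inner) \<Rightarrow> nat \<Rightarrow> 'a set" where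
  "gram_schmidt_seq d 0 = {}"
| "gram_schmidt_seq d (Suc n) = gram_schmidt_step (gram_schmidt_seq d n) (d n)"

lemma gram_schmidt_seq:
  "orthonormal (gram_schmidt_seq d n) \<and> finite (gram_schmidt_seq d n)"
proof (induction n)
  case 0
  show ?case by (simp add: orthonormal_def)
next
  case (Suc n)
  then show ?case using gram_schmidt_step(1,2) by auto
qed

lemma ex_orthonormal_basis:
  "\<exists>E::'a::{real_inner, second_countable_topology} set. orthonormal_basis E"
proof -
  obtain D :: "'a set" where D: "countable D" "\<And>X. open X \<Longrightarrow> X \<noteq> {} \<Longrightarrow> \<exists>d\<in>D. d \<in> X"
    using countable_dense_setE by blast
  have "D \<noteq> {}"
    using D(2)[of UNIV] by auto
  define d where "d = from_nat_into D"
  define E where "E = (\<Union>n. gram_schmidt_seq d n)"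
  have inc: "gram_schmidt_seq d m \<subseteq> gram_schmidt_seq d n" if "m \<le> n" for m n
    using that
  proof (induction n rule: dec_induct)
    case (step n)
    then show ?case
      using gram_schmidt_step(3)[of "gram_schmidt_seq d n" "d n"] gram_schmidt_seq[of d n] by auto
  qed simp
  have "pairwise orthogonal E"
  proof (rule pairwiseI)
    fix x y assume "x \<in> E" "y \<in> E" "x \<noteq> y"
    then obtain m n where "x \<in> gram_schmidt_seq d m" "y \<in> gram_schmidt_seq d n"
      by (auto simp: E_def)
    then have "x \<in> gram_schmidt_seq d (max m n)" "y \<in> gram_schmidt_seq d (max m n)"
      using inc[of m "max m n"] inc[of n "max m n"] by auto
    then show "orthogonal x y"
      using gram_schmidt_seq[of d "max m n"] \<open>x \<noteq> y\<close> by (auto simp: orthonormal_def pairwise_def)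
  qed
  moreover have "\<forall>e\<in>E. norm e = 1"
    using gram_schmidt_seq[of d] by (auto simp: E_def orthonormal_def)
  moreover have "D \<subseteq> span E"
  proof
    fix x assume "x \<in> D"
    then obtain n where n: "d n = x"
      using from_nat_into_surj[OF D(1)] d_def by metis
    have "x \<in> span (gram_schmidt_seq d (Suc n))"
      using gram_schmidt_step(4)[of "gram_schmidt_seq d n" "d n"] gram_schmidt_seq[of d n] n by simp
    moreover have "gram_schmidt_seq d (Suc n) \<subseteq> E"
      unfolding E_def by (rule UN_upper) simp
    ultimately show "x \<in> span E"
      using span_mono by (meson subsetD)
  qed
  then have "x \<in> closure (span E)" for x
    unfolding closure_iff_nhds_not_empty using D(2) by (metis disjoint_iff empty_iff subset_eq)
  then have "closure (span E) = UNIV"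
    by auto
  ultimately show ?thesis
    unfolding orthonormal_basis_def orthonormal_def by blast
qed

definition hilbert_basis :: "'a::{real_inner, second_countable_topology} set" where
  "hilbert_basis = (SOME E. orthonormal_basis E)"

lemma hilbert_basis: "orthonormal_basis hilbert_basis"
  unfolding hilbert_basis_def by (rule someI_ex) (rule ex_orthonormal_basis)


section \<open>Hilbert-Schmidt operators\<close>

text \<open>
  Neither the Hilbert-Schmidt property nor the inner product depends on the orthonormal basis
  (Parseval), so one basis is fixed once and for all.
\<close>

definition hilbert_schmidt ::
  "('k::separable_hilbert_space \<Rightarrow>\<^sub>L 'h::separable_hilbert_space) \<Rightarrow> bool" where
  "hilbert_schmidt T \<longleftrightarrow> (\<lambda>e. (norm (T e))\<^sup>2) summable_on hilbert_basis"

typedef (overloaded) ('k::separable_hilbert_space, 'h::separable_hilbert_space) hs =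
    "{T :: 'k \<Rightarrow>\<^sub>L 'h. hilbert_schmidt T}"
  morphisms blinfun_of_hs Hs
proof
  show "0 \<in> {T :: 'k \<Rightarrow>\<^sub>L 'h. hilbert_schmidt T}"
    by (simp add: hilbert_schmidt_def)
qed

setup_lifting type_definition_hs

lemma hilbert_schmidt_inner_summable:
  assumes "hilbert_schmidt S" "hilbert_schmidt T"
  shows "(\<lambda>e. S e \<bullet> T e) summable_on hilbert_basis"
proof (rule summable_on_iff_abs_summable_on_real[THEN iffD2], rule summable_on_comparison_test)
  show "(\<lambda>e. (norm (S e))\<^sup>2 + (norm (T e))\<^sup>2) summable_on hilbert_basis"
    using assms unfolding hilbert_schmidt_def by (rule summable_on_add)
  show "norm (S e \<bullet> T e) \<le> (norm (S e))\<^sup>2 + (norm (T e))\<^sup>2" for e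
  proof -
    have "norm (S e \<bullet> T e) \<le> norm (S e) * norm (T e)"
      using Cauchy_Schwarz_ineq2 by simp
    also have "\<dots> \<le> (norm (S e))\<^sup>2 + (norm (T e))\<^sup>2"
      using sum_squares_bound[of "norm (S e)" "norm (T e)"]
        mult_nonneg_nonneg[of "norm (S e)" "norm (T e)", OF norm_ge_zero norm_ge_zero]
      by linarith
    finally show ?thesis .
  qed
qed auto

lemma hilbert_schmidt_add:
  assumes "hilbert_schmidt S" "hilbert_schmidt T"
  shows "hilbert_schmidt (S + T)"
proof -
  have "(\<lambda>e. (norm (S e))\<^sup>2 + (norm (T e))\<^sup>2 + 2 * (S e \<bullet> T e)) summable_on hilbert_basis"
    using assms hilbert_schmidt_inner_summable[OF assms] unfolding hilbert_schmidt_def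
    by (intro summable_on_add summable_on_cmult_right)
  then show ?thesis
    unfolding hilbert_schmidt_def
    by (simp add: blinfun.add_left power2_norm_eq_inner inner_add_left inner_add_right inner_commute
        algebra_simps)
qed

lemma hilbert_schmidt_scaleR:
  assumes "hilbert_schmidt T"
  shows "hilbert_schmidt (c *\<^sub>R T)"
  using assms summable_on_cmult_right[of "\<lambda>e. (norm (T e))\<^sup>2" hilbert_basis "c\<^sup>2"]
  unfolding hilbert_schmidt_def by (simp add: blinfun.scaleR_left power_mult_distrib)

instantiation hs :: (separable_hilbert_space, separable_hilbert_space) real_vector
begin

lift_definition zero_hs :: "('a, 'b) hs" is 0
  by (simp add: hilbert_schmidt_def)

lift_definition plus_hs :: "('a, 'b) hs \<Rightarrow> ('a, 'b) hs \<Rightarrow> ('a, 'b) hs" is "(+)"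
  by (rule hilbert_schmidt_add)

lift_definition scaleR_hs :: "real \<Rightarrow> ('a, 'b) hs \<Rightarrow> ('a, 'b) hs" is "(*\<^sub>R)"
  by (rule hilbert_schmidt_scaleR)

lift_definition uminus_hs :: "('a, 'b) hs \<Rightarrow> ('a, 'b) hs" is uminus
  using hilbert_schmidt_scaleR[of _ "-1"] by simp

lift_definition minus_hs :: "('a, 'b) hs \<Rightarrow> ('a, 'b) hs \<Rightarrow> ('a, 'b) hs" is "(-)"
proof -
  fix S T :: "'a \<Rightarrow>\<^sub>L 'b"
  assume "hilbert_schmidt S" "hilbert_schmidt T"
  then show "hilbert_schmidt (S - T)"
    using hilbert_schmidt_add[of S "(-1) *\<^sub>R T"] hilbert_schmidt_scaleR[of T "-1"] by simp
qed

instance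
  by standard (transfer; simp add: scaleR_add_right scaleR_add_left)+

end

instantiation hs :: (separable_hilbert_space, separable_hilbert_space) real_inner
begin

lift_definition inner_hs :: "('a, 'b) hs \<Rightarrow> ('a, 'b) hs \<Rightarrow> real"
  is "\<lambda>S T. \<Sum>\<^sub>\<infinity>e\<in>hilbert_basis. blinfun_apply S e \<bullet> blinfun_apply T e" .

definition norm_hs :: "('a, 'b) hs \<Rightarrow> real" where
  "norm_hs T = sqrt (T \<bullet> T)"

definition dist_hs :: "('a, 'b) hs \<Rightarrow> ('a, 'b) hs \<Rightarrow> real" where
  "dist_hs S T = norm (S - T)"

definition sgn_hs :: "('a, 'b) hs \<Rightarrow> ('a, 'b) hs" where
  "sgn_hs T = T /\<^sub>R norm T"

definition uniformity_hs :: "(('a, 'b) hs \<times> ('a, 'b) hs) filter" where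
  "uniformity_hs = (INF e\<in>{0<..}. principal {(x, y). dist x y < e})"

definition open_hs :: "('a, 'b) hs set \<Rightarrow> bool" where
  "open_hs U \<longleftrightarrow> (\<forall>x\<in>U. \<forall>\<^sub>F (x', y) in uniformity. x' = x \<longrightarrow> y \<in> U)"

instance
proof
  fix r :: real and R S T :: "('a, 'b) hs" and U :: "('a, 'b) hs set"
  show "dist S T = norm (S - T)" "sgn T = T /\<^sub>R norm T" "norm T = sqrt (T \<bullet> T)"
    "uniformity = (INF e\<in>{0<..}. principal {(x::('a, 'b) hs, y). dist x y < e})"
    "open U \<longleftrightarrow> (\<forall>x\<in>U. \<forall>\<^sub>F (x', y) in uniformity. x' = x \<longrightarrow> y \<in> U)"
    by (simp_all add: dist_hs_def sgn_hs_def norm_hs_def uniformity_hs_def open_hs_def)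
  show "S \<bullet> T = T \<bullet> S"
    by transfer (simp add: inner_commute)
  show "(R + S) \<bullet> T = R \<bullet> T + S \<bullet> T"
    by transfer (simp add: blinfun.add_left inner_add_left infsum_add
        hilbert_schmidt_inner_summable)
  show "(r *\<^sub>R S) \<bullet> T = r * (S \<bullet> T)"
    by transfer (simp add: blinfun.scaleR_left infsum_cmult_right')
  show "0 \<le> T \<bullet> T"
    by transfer (simp add: infsum_nonneg)
  show "T \<bullet> T = 0 \<longleftrightarrow> T = 0"
  proof transfer
    fix T :: "'a \<Rightarrow>\<^sub>L 'b" assume T: "hilbert_schmidt T"
    have "T = 0" if "(\<Sum>\<^sub>\<infinity>e\<in>hilbert_basis. T e \<bullet> T e) = 0"
    proof -
      have "T e = 0" if "e \<in> hilbert_basis" for e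
        using nonneg_infsum_le_0D[of "\<lambda>e. T e \<bullet> T e" hilbert_basis e] that
          \<open>(\<Sum>\<^sub>\<infinity>e\<in>hilbert_basis. T e \<bullet> T e) = 0\<close> hilbert_schmidt_inner_summable[OF T T]
        by simp
      then have "T x = 0" if "x \<in> span hilbert_basis" for x
        by (rule linear_eq_0_on_span[OF bounded_linear.linear[OF blinfun.bounded_linear_right] _ that])
      then have "T x = 0" if "x \<in> closure (span hilbert_basis)" for x
        using that continuous_constant_on_closure[of "span hilbert_basis" "blinfun_apply T" 0 x]
          linear_continuous_on[OF blinfun.bounded_linear_right] by blast
      then show "T = 0"
        using hilbert_basis[where 'a = 'a] unfolding orthonormal_basis_def
        by (intro blinfun_eqI) simp
    qed
    then show "(\<Sum>\<^sub>\<infinity>e\<in>hilbert_basis. T e \<bullet> T e) = 0 \<longleftrightarrow> T = 0"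
      by auto
  qed
qed

end

lemma bessel_summable:
  assumes "orthonormal E"
  shows "(\<lambda>e. (k \<bullet> e)\<^sup>2) summable_on E"
proof (rule nonneg_bdd_above_summable_on)
  have "(\<Sum>e\<in>G. (k \<bullet> e)\<^sup>2) \<le> (norm k)\<^sup>2" if G: "G \<subseteq> E" "finite G" for G
  proof -
    have on: "orthonormal G"
      using assms G(1) unfolding orthonormal_def by (auto intro: pairwise_subset)
    define p where "p = (\<Sum>e\<in>G. (k \<bullet> e) *\<^sub>R e)"
    have kp: "k \<bullet> p = (\<Sum>e\<in>G. (k \<bullet> e)\<^sup>2)"
      by (simp add: p_def inner_sum_right power2_eq_square)
    have res: "p \<bullet> (k - p) = 0"
      using gram_schmidt_residual_orthogonal[OF on G(2), of _ k]
      by (simp add: p_def inner_sum_left gram_schmidt_residual_def)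
    have "0 \<le> (k - p) \<bullet> (k - p)" by simp
    also have "\<dots> = k \<bullet> k - k \<bullet> p"
      using res by (simp add: inner_diff_left inner_diff_right inner_commute)
    finally show ?thesis by (simp add: kp power2_norm_eq_inner)
  qed
  then show "bdd_above (sum (\<lambda>e. (k \<bullet> e)\<^sup>2) ` {F. F \<subseteq> E \<and> finite F})"
    by (intro bdd_aboveI[of _ "(norm k)\<^sup>2"]) auto
qed simp

lift_definition rank_one ::
  "'h::separable_hilbert_space \<Rightarrow> 'k::separable_hilbert_space \<Rightarrow> ('k, 'h) hs"
  is "\<lambda>h k. blinfun_scaleR_left h o\<^sub>L blinfun_inner_right k"
proof -
  fix h :: 'h and k :: 'k
  have "(\<lambda>e. (norm h)\<^sup>2 * (k \<bullet> e)\<^sup>2) summable_on hilbert_basis"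
    using hilbert_basis unfolding orthonormal_basis_def
    by (intro summable_on_cmult_right bessel_summable) auto
  then show "hilbert_schmidt (blinfun_scaleR_left h o\<^sub>L blinfun_inner_right k)"
    by (simp add: hilbert_schmidt_def power_mult_distrib mult.commute)
qed

lemma rank_one_apply: "blinfun_of_hs (rank_one h k) x = (k \<bullet> x) *\<^sub>R h"
  by transfer simp


section \<open>Unbounded operators and semigroups\<close>

text \<open>
  A possibly unbounded operator is a function together with its domain; its values outside the
  domain are irrelevant.
\<close>

definition linear_operator :: "'a::real_vector set \<Rightarrow> ('a \<Rightarrow> 'b::real_vector) \<Rightarrow> bool" where
  "linear_operator D A \<longleftrightarrow> subspace D \<and>
     (\<forall>x\<in>D. \<forall>y\<in>D. A (x + y) = A x + A y) \<and> (\<forall>c. \<forall>x\<in>D. A (c *\<^sub>R x) = c *\<^sub>R A x)"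

definition dissipative :: "'a::real_inner set \<Rightarrow> ('a \<Rightarrow> 'a) \<Rightarrow> bool" where
  "dissipative D A \<longleftrightarrow> (\<forall>x\<in>D. A x \<bullet> x \<le> 0)"

definition adjoint_dom :: "'a::real_inner set \<Rightarrow> ('a \<Rightarrow> 'a) \<Rightarrow> 'a set" where
  "adjoint_dom D A = {y. \<exists>z. \<forall>x\<in>D. A x \<bullet> y = x \<bullet> z}"

definition adjoint_op :: "'a::real_inner set \<Rightarrow> ('a \<Rightarrow> 'a) \<Rightarrow> 'a \<Rightarrow> 'a" where
  "adjoint_op D A y = (THE z. \<forall>x\<in>D. A x \<bullet> y = x \<bullet> z)"

definition C0_semigroup :: "(real \<Rightarrow> 'h::real_normed_vector \<Rightarrow>\<^sub>L 'h) \<Rightarrow> bool" where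
  "C0_semigroup S \<longleftrightarrow> S 0 = id_blinfun \<and>
     (\<forall>s\<ge>0. \<forall>t\<ge>0. S (s + t) = S s o\<^sub>L S t) \<and>
     (\<forall>x. ((\<lambda>t. S t x) \<longlongrightarrow> x) (at_right 0))"

definition is_generator ::
  "(real \<Rightarrow> 'h::real_normed_vector \<Rightarrow>\<^sub>L 'h) \<Rightarrow> 'h set \<Rightarrow> ('h \<Rightarrow> 'h) \<Rightarrow> bool" where
  "is_generator S D A \<longleftrightarrow>
     D = {x. \<exists>y. ((\<lambda>t. (S t x - x) /\<^sub>R t) \<longlongrightarrow> y) (at_right 0)} \<and>
     (\<forall>x\<in>D. ((\<lambda>t. (S t x - x) /\<^sub>R t) \<longlongrightarrow> A x) (at_right 0))"

definition exponentially_stable :: "(real \<Rightarrow> 'h::real_normed_vector \<Rightarrow>\<^sub>L 'h) \<Rightarrow> bool" where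
  "exponentially_stable S \<longleftrightarrow> (\<exists>M>0. \<exists>\<omega>>0. \<forall>t\<ge>0. norm (S t) \<le> M * exp (- \<omega> * t))"

text \<open>
  \<open>hs_extension D f T\<close>: the densely defined map \<open>f\<close>, with values in \<open>L(K, H)\<close>, extends to the
  bounded operator \<open>T\<close> with values in the Hilbert-Schmidt operators. The extension is unique, and
  products such as \<open>S t C\<close> are identified with it.
\<close>

definition hs_extension ::
  "'h::separable_hilbert_space set \<Rightarrow> ('h \<Rightarrow> 'k::separable_hilbert_space \<Rightarrow>\<^sub>L 'h) \<Rightarrow>
   ('h \<Rightarrow>\<^sub>L ('k, 'h) hs) \<Rightarrow> bool" where
  "hs_extension D f T \<longleftrightarrow> closure D = UNIV \<and> (\<forall>x\<in>D. blinfun_of_hs (T x) = f x)"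

definition the_hs_extension ::
  "'h::separable_hilbert_space set \<Rightarrow> ('h \<Rightarrow> 'k::separable_hilbert_space \<Rightarrow>\<^sub>L 'h) \<Rightarrow>
   'h \<Rightarrow>\<^sub>L ('k, 'h) hs" where
  "the_hs_extension D f = (THE T. hs_extension D f T)"

definition semigroup_noise ::
  "(real \<Rightarrow> 'h \<Rightarrow>\<^sub>L 'h) \<Rightarrow> 'h set \<Rightarrow>
   ('h::separable_hilbert_space \<Rightarrow> 'k::separable_hilbert_space \<Rightarrow>\<^sub>L 'h) \<Rightarrow>
   real \<Rightarrow> 'h \<Rightarrow>\<^sub>L ('k, 'h) hs" where
  "semigroup_noise S DC C t = the_hs_extension DC (\<lambda>x. S t o\<^sub>L C x)"

definition noise_semigroup ::
  "(real \<Rightarrow> 'h \<Rightarrow>\<^sub>L 'h) \<Rightarrow>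
   ('h::separable_hilbert_space \<Rightarrow> 'k::separable_hilbert_space \<Rightarrow>\<^sub>L 'h) \<Rightarrow>
   real \<Rightarrow> 'h \<Rightarrow>\<^sub>L ('k, 'h) hs" where
  "noise_semigroup S C t = the_hs_extension UNIV (\<lambda>x. C (S t x))"

definition admissible_noise ::
  "(real \<Rightarrow> 'h \<Rightarrow>\<^sub>L 'h) \<Rightarrow> 'h set \<Rightarrow>
   ('h::separable_hilbert_space \<Rightarrow> 'k::separable_hilbert_space \<Rightarrow>\<^sub>L 'h) \<Rightarrow> bool" where
  "admissible_noise S DC C \<longleftrightarrow> linear_operator DC C \<and>
     (\<exists>\<gamma> L. 0 \<le> \<gamma> \<and> \<gamma> < 1/2 \<and> 0 < L \<and>
       (\<forall>t>0. (\<exists>T. hs_extension DC (\<lambda>x. S t o\<^sub>L C x) T) \<and>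
              norm (semigroup_noise S DC C t) \<le> L * t powr (- \<gamma>))) \<and>
     (\<forall>t>0. \<forall>x. S t x \<in> DC \<and> hilbert_schmidt (C (S t x)))"


section \<open>Structural assumptions on the noise operator\<close>

definition assumption_A1 ::
  "(real \<Rightarrow> 'h \<Rightarrow>\<^sub>L 'h) \<Rightarrow> 'h set \<Rightarrow> ('h \<Rightarrow> 'h) \<Rightarrow> 'h set \<Rightarrow>
   ('h::separable_hilbert_space \<Rightarrow> 'k::separable_hilbert_space \<Rightarrow>\<^sub>L 'h) \<Rightarrow>
   'h set \<Rightarrow> ('h \<Rightarrow> 'k \<Rightarrow>\<^sub>L 'h) \<Rightarrow> ('h \<Rightarrow>\<^sub>L ('k, 'h) hs) \<Rightarrow> bool" where
  "assumption_A1 S DA A DC C D1 C1 C2 \<longleftrightarrow>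
     linear_operator D1 C1 \<and>
     DC = D1 \<and> (\<forall>x\<in>D1. C x = C1 x + blinfun_of_hs (C2 x)) \<and>
     (\<exists>\<gamma> L. 0 \<le> \<gamma> \<and> \<gamma> < 1/2 \<and> 0 < L \<and>
       (\<forall>t>0. (\<forall>x. S t x \<in> D1) \<and> (\<exists>T. hs_extension UNIV (\<lambda>x. C1 (S t x)) T) \<and>
              norm (noise_semigroup S C1 t) \<le> L * t powr (- \<gamma>))) \<and>
     (\<exists>a>1/2. \<exists>\<delta>::nat \<Rightarrow> real. (\<forall>n. 0 < \<delta> n) \<and> decseq \<delta> \<and> \<delta> \<longlonglongrightarrow> 0 \<and>
       (\<forall>n. let T = noise_semigroup S C1 (\<delta> n)
            in dissipative DA (\<lambda>x. A x + a *\<^sub>R adjoint (blinfun_apply T) (T x))))"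

definition assumption_A2 ::
  "'h set \<Rightarrow> ('h \<Rightarrow> 'h) \<Rightarrow> 'h set \<Rightarrow>
   ('h::separable_hilbert_space \<Rightarrow> 'k::separable_hilbert_space \<Rightarrow>\<^sub>L 'h) \<Rightarrow> bool" where
  "assumption_A2 DA A D1 C1 \<longleftrightarrow>
     ((\<exists>x\<in>D1. C1 x \<noteq> 0) \<longrightarrow> dissipative {x\<in>DA. A x \<in> DA} (\<lambda>x. - A (A x)))"


section \<open>Stochastic basis and cylindrical Wiener process\<close>

definition stochastic_basis :: "'w measure \<Rightarrow> (real \<Rightarrow> 'w measure) \<Rightarrow> bool" where
  "stochastic_basis M F \<longleftrightarrow> prob_space M \<and>
     (\<forall>N\<in>null_sets M. \<forall>B. B \<subseteq> N \<longrightarrow> B \<in> sets M) \<and>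
     (\<forall>t\<ge>0. subalgebra M (F t)) \<and>
     (\<forall>s\<ge>0. \<forall>t\<ge>s. sets (F s) \<subseteq> sets (F t)) \<and>
     null_sets M \<subseteq> sets (F 0) \<and>
     (\<forall>t\<ge>0. sets (F t) = (\<Inter>s\<in>{t<..}. sets (F s)))"

definition progressively_measurable ::
  "(real \<Rightarrow> 'w measure) \<Rightarrow> (real \<Rightarrow> 'w \<Rightarrow> 'b::topological_space) \<Rightarrow> bool" where
  "progressively_measurable F X \<longleftrightarrow>
     (\<forall>T\<ge>0. (\<lambda>(t, \<omega>). X t \<omega>) \<in> borel_measurable (restrict_space borel {0..T} \<Otimes>\<^sub>M F T))"

definition brownian_motion ::
  "'w measure \<Rightarrow> (real \<Rightarrow> 'w measure) \<Rightarrow> (real \<Rightarrow> 'w \<Rightarrow> real) \<Rightarrow> bool" where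
  "brownian_motion M F b \<longleftrightarrow>
     (\<forall>t\<ge>0. b t \<in> borel_measurable (F t)) \<and>
     (AE \<omega> in M. b 0 \<omega> = 0) \<and>
     (AE \<omega> in M. continuous_on {0..} (\<lambda>t. b t \<omega>)) \<and>
     (\<forall>s\<ge>0. \<forall>t>s.
        distributed M lborel (\<lambda>\<omega>. b t \<omega> - b s \<omega>) (normal_density 0 (sqrt (t - s))) \<and>
        prob_space.indep_set M (sets (F s))
          {(\<lambda>\<omega>. b t \<omega> - b s \<omega>) -` B \<inter> space M | B. B \<in> sets borel})"

text \<open>
  \<open>W t k\<close> stands for the pairing of the cylindrical process with the direction \<open>k\<close>. Linearity
  together with unit variance in every unit direction gives the covariance
  \<open>E (W t k * W s l) = min s t * (k \<bullet> l)\<close> by polarization.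
\<close>

definition cylindrical_wiener ::
  "'w measure \<Rightarrow> (real \<Rightarrow> 'w measure) \<Rightarrow>
   (real \<Rightarrow> 'k::separable_hilbert_space \<Rightarrow> 'w \<Rightarrow> real) \<Rightarrow> bool" where
  "cylindrical_wiener M F W \<longleftrightarrow>
     (\<forall>k. norm k = 1 \<longrightarrow> brownian_motion M F (\<lambda>t. W t k)) \<and>
     (\<forall>t\<ge>0. \<forall>k. W t k \<in> borel_measurable (F t)) \<and>
     (\<forall>t\<ge>0. \<forall>a b k l. AE \<omega> in M. W t (a *\<^sub>R k + b *\<^sub>R l) \<omega> = a * W t k \<omega> + b * W t l \<omega>)"


section \<open>Stochastic integral\<close>

text \<open>
  A list of quadruples \<open>(a, b, k, h)\<close> encodes the elementary process that is the sum of the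
  processes \<open>1_(a,b] \<otimes> <k, \<cdot>> h\<close>, with \<open>h\<close> bounded and measurable at time \<open>a\<close>. The intervals may
  overlap; passing to a common refinement gives the usual form over a partition.
\<close>

type_synonym ('k, 'h, 'w) elementary = "(real \<times> real \<times> 'k \<times> ('w \<Rightarrow> 'h)) list"

definition elementary_on ::
  "(real \<Rightarrow> 'w measure) \<Rightarrow> real \<Rightarrow>
   ('k::separable_hilbert_space, 'h::separable_hilbert_space, 'w) elementary \<Rightarrow> bool" where
  "elementary_on F T es \<longleftrightarrow> (\<forall>(a, b, k, h)\<in>set es.
     0 \<le> a \<and> a \<le> b \<and> b \<le> T \<and> h \<in> borel_measurable (F a) \<and> bounded (h ` space (F a)))"

definition elementary_process ::
  "('k::separable_hilbert_space, 'h::separable_hilbert_space, 'w) elementary \<Rightarrow>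
   real \<Rightarrow> 'w \<Rightarrow> ('k, 'h) hs" where
  "elementary_process es s \<omega> =
     (\<Sum>(a, b, k, h)\<leftarrow>es. indicator {a<..b} s *\<^sub>R rank_one (h \<omega>) k)"

definition elementary_integral ::
  "(real \<Rightarrow> 'k \<Rightarrow> 'w \<Rightarrow> real) \<Rightarrow>
   ('k::separable_hilbert_space, 'h::separable_hilbert_space, 'w) elementary \<Rightarrow> 'w \<Rightarrow> 'h" where
  "elementary_integral W es \<omega> = (\<Sum>(a, b, k, h)\<leftarrow>es. (W b k \<omega> - W a k \<omega>) *\<^sub>R h \<omega>)"

text \<open>
  The Ito integral over \<open>[0, T]\<close> of a square integrable progressively measurable integrand, as
  the mean square limit of integrals of elementary processes; it is determined up to null sets.
\<close>

definition has_stochastic_integral ::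
  "'w measure \<Rightarrow> (real \<Rightarrow> 'w measure) \<Rightarrow> (real \<Rightarrow> 'k \<Rightarrow> 'w \<Rightarrow> real) \<Rightarrow> real \<Rightarrow>
   (real \<Rightarrow> 'w \<Rightarrow> ('k::separable_hilbert_space, 'h::separable_hilbert_space) hs) \<Rightarrow>
   ('w \<Rightarrow> 'h) \<Rightarrow> bool" where
  "has_stochastic_integral M F W T \<Phi> I \<longleftrightarrow>
     progressively_measurable F \<Phi> \<and>
     (\<integral>\<^sup>+\<omega>. (\<integral>\<^sup>+s\<in>{0..T}. ennreal ((norm (\<Phi> s \<omega>))\<^sup>2) \<partial>lborel) \<partial>M) < \<infinity> \<and>
     I \<in> borel_measurable (F T) \<and>
     (\<exists>es. (\<forall>n. elementary_on F T (es n)) \<and>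
       (\<lambda>n. \<integral>\<^sup>+\<omega>. (\<integral>\<^sup>+s\<in>{0..T}.
          ennreal ((norm (elementary_process (es n) s \<omega> - \<Phi> s \<omega>))\<^sup>2) \<partial>lborel) \<partial>M) \<longlonglongrightarrow> 0 \<and>
       (\<lambda>n. \<integral>\<^sup>+\<omega>. ennreal ((norm (elementary_integral W (es n) \<omega> - I \<omega>))\<^sup>2) \<partial>M) \<longlonglongrightarrow> 0)"


section \<open>The controlled equation\<close>

definition admissible_control ::
  "'w measure \<Rightarrow> (real \<Rightarrow> 'w measure) \<Rightarrow>
   (real \<Rightarrow> 'w \<Rightarrow> 'u::separable_hilbert_space) \<Rightarrow> bool" where
  "admissible_control M F u \<longleftrightarrow> progressively_measurable F u \<and>
     (\<forall>T>0. (\<integral>\<^sup>+\<omega>. (\<integral>\<^sup>+t\<in>{0..T}. ennreal ((norm (u t \<omega>))\<^sup>2) \<partial>lborel) \<partial>M) < \<infinity>)"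

definition mild_solution ::
  "'w measure \<Rightarrow> (real \<Rightarrow> 'w measure) \<Rightarrow> (real \<Rightarrow> 'k \<Rightarrow> 'w \<Rightarrow> real) \<Rightarrow>
   (real \<Rightarrow> 'h \<Rightarrow>\<^sub>L 'h) \<Rightarrow> ('u \<Rightarrow>\<^sub>L 'h) \<Rightarrow> 'h set \<Rightarrow>
   ('h::separable_hilbert_space \<Rightarrow> 'k::separable_hilbert_space \<Rightarrow>\<^sub>L 'h) \<Rightarrow>
   'h \<Rightarrow> (real \<Rightarrow> 'w \<Rightarrow> 'u::separable_hilbert_space) \<Rightarrow> (real \<Rightarrow> 'w \<Rightarrow> 'h) \<Rightarrow> bool" where
  "mild_solution M F W S B DC C x u X \<longleftrightarrow>
     progressively_measurable F X \<and>
     (\<forall>T>0. (\<integral>\<^sup>+\<omega>. (SUP s\<in>{0..T}. ennreal ((norm (X s \<omega>))\<^sup>2)) \<partial>M) < \<infinity>) \<and>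
     (AE \<omega> in M. X 0 \<omega> = x) \<and>
     (\<forall>t>0. \<exists>I.
        has_stochastic_integral M F W t
          (\<lambda>s \<omega>. if s < t then semigroup_noise S DC C (t - s) (X s \<omega>) else 0) I \<and>
        (AE \<omega> in M. X t \<omega> = S t x + (LBINT s:{0..t}. S (t - s) (B (u s \<omega>))) + I \<omega>))"

definition approximately_controllable ::
  "'w measure \<Rightarrow> (real \<Rightarrow> 'w measure) \<Rightarrow> (real \<Rightarrow> 'k \<Rightarrow> 'w \<Rightarrow> real) \<Rightarrow>
   (real \<Rightarrow> 'h \<Rightarrow>\<^sub>L 'h) \<Rightarrow> ('u::separable_hilbert_space \<Rightarrow>\<^sub>L 'h) \<Rightarrow> 'h set \<Rightarrow>
   ('h::separable_hilbert_space \<Rightarrow> 'k::separable_hilbert_space \<Rightarrow>\<^sub>L 'h) \<Rightarrow> bool" where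
  "approximately_controllable M F W S B DC C \<longleftrightarrow>
     (\<forall>x. \<forall>T>0. \<forall>\<xi> \<epsilon>. \<xi> \<in> borel_measurable (F T) \<and>
        (\<integral>\<^sup>+\<omega>. ennreal ((norm (\<xi> \<omega>))\<^sup>2) \<partial>M) < \<infinity> \<and> 0 < \<epsilon> \<longrightarrow>
        (\<exists>u X. admissible_control M F u \<and> mild_solution M F W S B DC C x u X \<and>
           (\<integral>\<^sup>+\<omega>. ennreal ((norm (X T \<omega> - \<xi> \<omega>))\<^sup>2) \<partial>M) \<le> ennreal \<epsilon>))"

end

(*
  If A* y = alpha y and B* y = 0, then S(t)* y = exp(alpha t) y, so the drift of the mild solution is
  invisible in the direction y: started at 0, its pairing with y is that of an Ito integral and has
  mean zero whatever the control. Hence the deterministic target y, whose pairing with itself is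
  positive, cannot be approximated in mean square.
*)
theory Submission
  imports Defs
begin

section \<open>Riesz representation and adjoints of bounded operators\<close>

text \<open>A vector \<open>w\<close> of least norm on the hyperplane where \<open>f\<close> equals
  1 is orthogonal to the kernel of \<open>f\<close>. Since \<open>x - f x *\<^sub>R w\<close> lies
  in that kernel, pairing it with \<open>w\<close> yields the representer
  \<open>w /\<^sub>R (w \<bullet> w)\<close>.\<close>

lemma riesz_representation:
  fixes f :: "'a::{real_inner, banach} \<Rightarrow> real"
  assumes "bounded_linear f"
  shows "\<exists>z. \<forall>x. f x = x \<bullet> z"
proof (cases "\<forall>x. f x = 0")
  case True
  then show ?thesis by (intro exI[of _ 0]) simp
next
  case False
  interpret bounded_linear f by fact
  define N where "N = {x. f x = 1}"
  obtain x0 where "f x0 \<noteq> 0" using False by auto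
  then have "x0 /\<^sub>R f x0 \<in> N" by (simp add: N_def scaleR)
  then have N: "N \<noteq> {}" by auto
  define d where "d = Inf (norm ` N)"
  have bdd: "bdd_below (norm ` N)" by (auto intro: bdd_belowI[of _ 0])
  have d_le: "d \<le> norm x" if "x \<in> N" for x
    unfolding d_def using that bdd by (intro cInf_lower) auto
  have d0: "0 \<le> d" unfolding d_def using N by (intro cInf_greatest) auto
  have "\<exists>x\<in>N. norm x < d + inverse (Suc n)" for n
    using cInf_lessD[of "norm ` N" "d + inverse (Suc n)"] N unfolding d_def[symmetric] by auto
  then obtain v where v: "v n \<in> N" "norm (v n) < d + inverse (Suc n)" for n
    by metis
  \<comment> \<open>The midpoint of two points of \<open>N\<close> is again in \<open>N\<close>, so
    its norm is at least \<open>d\<close>. This is what forces a minimizing sequence to be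
    Cauchy.\<close>
  have parallelogram: "(norm (x - y))\<^sup>2 \<le> 2 * (norm x)\<^sup>2 + 2 * (norm y)\<^sup>2 - 4 * d\<^sup>2"
    if "x \<in> N" "y \<in> N" for x y
  proof -
    have "(1/2) *\<^sub>R (x + y) \<in> N" using that by (simp add: N_def add scaleR)
    then have "d \<le> norm ((1/2) *\<^sub>R (x + y))" by (rule d_le)
    then have "(2 * d)\<^sup>2 \<le> (norm (x + y))\<^sup>2" using d0 by (intro power_mono) auto
    moreover have "(norm (x - y))\<^sup>2 + (norm (x + y))\<^sup>2 = 2 * (norm x)\<^sup>2 + 2 * (norm y)\<^sup>2"
      by (simp add: power2_norm_eq_inner inner_diff_left inner_diff_right inner_add_left
          inner_add_right inner_commute)
    ultimately show ?thesis by (simp add: power_mult_distrib)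
  qed
  have norm_v: "(\<lambda>n. norm (v n)) \<longlonglongrightarrow> d"
  proof (rule tendsto_sandwich[of "\<lambda>_. d" _ _ "\<lambda>n. d + inverse (real (Suc n))"])
    show "(\<lambda>n. d + inverse (real (Suc n))) \<longlonglongrightarrow> d"
      using tendsto_add[OF tendsto_const[of d] LIMSEQ_inverse_real_of_nat] by simp
  qed (use v d_le in \<open>auto intro!: always_eventually less_imp_le\<close>)
  have "Cauchy v"
  proof (rule metric_CauchyI)
    fix e :: real assume e: "0 < e"
    have "(\<lambda>n. (norm (v n))\<^sup>2) \<longlonglongrightarrow> d\<^sup>2" using norm_v by (intro tendsto_power)
    \<comment> \<open>The slack is chosen so that \<open>parallelogram\<close> yields exactly 4 *
      (e^2 / 4) = e^2.\<close>
    moreover have "d\<^sup>2 < d\<^sup>2 + e\<^sup>2 / 4" using e by simp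
    ultimately have "\<forall>\<^sub>F n in sequentially. (norm (v n))\<^sup>2 < d\<^sup>2 + e\<^sup>2 / 4"
      by (rule order_tendstoD)
    then obtain K where K: "(norm (v n))\<^sup>2 < d\<^sup>2 + e\<^sup>2 / 4" if "n \<ge> K" for n
      by (auto simp: eventually_sequentially)
    have "dist (v m) (v n) < e" if "m \<ge> K" "n \<ge> K" for m n
    proof -
      have "(norm (v m - v n))\<^sup>2 < e\<^sup>2"
        using parallelogram[OF v(1) v(1), of m n] K[OF that(1)] K[OF that(2)] by linarith
      then show ?thesis using e by (simp add: dist_norm power2_less_imp_less)
    qed
    then show "\<exists>K. \<forall>m\<ge>K. \<forall>n\<ge>K. dist (v m) (v n) < e" by blast
  qed
  then obtain w where w: "v \<longlonglongrightarrow> w" using Cauchy_convergent convergent_def by blast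
  have "(\<lambda>n. f (v n)) \<longlonglongrightarrow> f w" by (rule tendsto[OF w])
  moreover have "(\<lambda>n. f (v n)) = (\<lambda>n. 1)" using v by (auto simp: N_def)
  ultimately have fw: "f w = 1" using LIMSEQ_unique tendsto_const by metis
  have nw: "norm w = d" using LIMSEQ_unique[OF norm_v tendsto_norm[OF w]] by simp
  have orth: "w \<bullet> x = 0" if "f x = 0" for x
  proof (rule ccontr)
    assume neq: "w \<bullet> x \<noteq> 0"
    then have x: "0 < x \<bullet> x" by auto
    \<comment> \<open>\<open>t *\<^sub>R x\<close> is the orthogonal projection of \<open>w\<close>
      onto the line through \<open>x\<close>. Subtracting it stays in \<open>N\<close> and would
      strictly shorten \<open>w\<close>.\<close>
    define t where "t = (w \<bullet> x) / (x \<bullet> x)"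
    have "w - t *\<^sub>R x \<in> N" using fw that by (simp add: N_def diff scaleR)
    then have "norm w \<le> norm (w - t *\<^sub>R x)" using d_le nw by simp
    then have "w \<bullet> w \<le> (w - t *\<^sub>R x) \<bullet> (w - t *\<^sub>R x)" by (simp add: norm_le)
    also have "\<dots> = w \<bullet> w - (w \<bullet> x)\<^sup>2 / (x \<bullet> x)"
      using x by (simp add: t_def inner_diff_left inner_diff_right inner_commute power2_eq_square)
    also have "\<dots> < w \<bullet> w" using neq x by simp
    finally show False by simp
  qed
  have "w \<noteq> 0" using fw zero by auto
  then have ww: "w \<bullet> w \<noteq> 0" by simp
  have "f x = x \<bullet> (w /\<^sub>R (w \<bullet> w))" for x
  proof -
    have "w \<bullet> (x - f x *\<^sub>R w) = 0" by (rule orth) (simp add: diff scaleR fw)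
    then show ?thesis using ww by (simp add: inner_diff_right inner_commute field_simps)
  qed
  then show ?thesis by blast
qed

text \<open>\<open>adjoint\<close> is defined by choice and has its defining property only once some
  adjoint map exists. The Riesz theorem, applied to the functional \<open>T x \<bullet> y\<close> of
  \<open>x\<close> for each fixed \<open>y\<close>, supplies one.\<close>

lemma adjoint_blinfun:
  fixes T :: "'a::{real_inner, banach} \<Rightarrow>\<^sub>L 'b::real_inner"
  shows "T x \<bullet> y = x \<bullet> adjoint T y"
proof -
  have "\<exists>z. \<forall>x. T x \<bullet> y = x \<bullet> z" for y
    by (rule riesz_representation)
       (rule bounded_linear_compose[OF bounded_linear_inner_left blinfun.bounded_linear_right])
  then obtain g where g: "\<forall>x y. T x \<bullet> y = x \<bullet> g y" by metis
  show ?thesis using adjoint_unique[OF g] g by simp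
qed

section \<open>C0-semigroups, generators and eigenvectors of the adjoint generator\<close>

text \<open>Translates derivatives, as the fundamental theorem of calculus delivers them, into the
  one-sided difference quotients that \<open>is_generator\<close> speaks of.\<close>

lemma has_vector_derivative_imp_right_quotient:
  fixes f :: "real \<Rightarrow> 'a::real_normed_vector"
  assumes "(f has_vector_derivative f') (at x within {x..b})" "x < b"
  shows "((\<lambda>h. (f (x + h) - f x) /\<^sub>R h) \<longlongrightarrow> f') (at_right 0)"
proof -
  have "((\<lambda>y. (1 / norm (y - x)) *\<^sub>R (f y - (f x + (y - x) *\<^sub>R f'))) \<longlongrightarrow> 0) (at_right x)"
    using assms by (simp add: has_vector_derivative_def has_derivative_within at_within_Icc_at_right)
  then have "((\<lambda>h. (1 / norm h) *\<^sub>R (f (x + h) - (f x + h *\<^sub>R f'))) \<longlongrightarrow> 0) (at_right 0)"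
    by (subst (asm) filterlim_at_right_to_0) (simp add: add.commute)
  then have "((\<lambda>h. (1 / norm h) *\<^sub>R (f (x + h) - (f x + h *\<^sub>R f')) + f') \<longlongrightarrow> 0 + f') (at_right 0)"
    by (intro tendsto_add tendsto_const)
  moreover have "\<forall>\<^sub>F h in at_right 0.
      (1 / norm h) *\<^sub>R (f (x + h) - (f x + h *\<^sub>R f')) + f' = (f (x + h) - f x) /\<^sub>R h"
    unfolding eventually_at_right_field
    by (intro exI[of _ 1]) (auto simp: algebra_simps scaleR_add_right divide_inverse)
  ultimately show ?thesis using tendsto_cong by fastforce
qed

text \<open>For a <= b, \<open>S b x - S a x\<close> is \<open>S a\<close> applied to
  \<open>S (b - a) x - x\<close>. The uniform bound thus carries right continuity at 0 to every
  time, and from the left as well, because the estimate depends only on b - a.\<close>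

lemma C0_semigroup_continuous_on:
  assumes S: "C0_semigroup S" and K: "\<And>t. 0 \<le> t \<Longrightarrow> norm (S t) \<le> K"
  shows "continuous_on {0..} (\<lambda>t. S t x)"
  unfolding continuous_on_iff
proof (intro ballI allI impI)
  fix s e :: real assume s: "s \<in> {0..}" and e: "0 < e"
  have K0: "0 \<le> K" using K[of 0] norm_ge_zero order_trans by blast
  have lim: "((\<lambda>h. S h x) \<longlongrightarrow> x) (at_right 0)" using S by (simp add: C0_semigroup_def)
  \<comment> \<open>Dividing by \<open>K + 1\<close> covers \<open>K = 0\<close> and keeps the final
    estimate strictly below \<open>e\<close>.\<close>
  have "\<forall>\<^sub>F h in at_right 0. dist (S h x) x < e / (K + 1)"
    using tendstoD[OF lim, of "e / (K + 1)"] e K0 by simp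
  then obtain d where d: "0 < d" "\<And>h. 0 < h \<Longrightarrow> h < d \<Longrightarrow> dist (S h x) x < e / (K + 1)"
    by (auto simp: eventually_at_right_field)
  have close: "dist (S b x) (S a x) < e" if "0 \<le> a" "a \<le> b" "b - a < d" for a b
  proof (cases "a = b")
    case False
    have "S b = S a o\<^sub>L S (b - a)"
      using S that unfolding C0_semigroup_def
      by (metis add.commute diff_add_cancel diff_ge_0_iff_ge)
    then have "dist (S b x) (S a x) = norm (S a (S (b - a) x - x))"
      by (simp add: dist_norm blinfun.diff_right)
    also have "\<dots> \<le> K * dist (S (b - a) x) x"
      unfolding dist_norm using norm_blinfun[of "S a"] K[OF that(1)]
      by (meson mult_right_mono norm_ge_zero order_trans)
    also have "\<dots> \<le> K * (e / (K + 1))"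
      using d(2)[of "b - a"] that False by (intro mult_left_mono K0) simp
    also have "\<dots> < e" using K0 e by (simp add: field_simps)
    finally show ?thesis .
  qed (use e in simp)
  show "\<exists>d>0. \<forall>t\<in>{0..}. dist t s < d \<longrightarrow> dist (S t x) (S s x) < e"
  proof (intro exI[of _ d] conjI ballI impI)
    fix t assume "t \<in> {0..}" "dist t s < d"
    then show "dist (S t x) (S s x) < e"
      using close[of s t] close[of t s] s by (cases "s \<le> t") (auto simp: dist_commute dist_real_def)
  qed (fact d)
qed

text \<open>This is the integrated form of the evolution equation, valid for every \<open>x\<close>
  of the space. The semigroup law turns the difference quotient of the integral into a difference of
  two quotients of \<open>G\<close>, taken at \<open>r\<close> and at 0, which tend to
  \<open>S r x\<close> and \<open>x\<close>.\<close>

lemma generator_integral: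
  fixes S :: "real \<Rightarrow> 'h::banach \<Rightarrow>\<^sub>L 'h"
  assumes S: "C0_semigroup S" and cont: "\<And>x. continuous_on {0..} (\<lambda>t. S t x)"
    and gen: "is_generator S D A" and r: "0 \<le> r"
  shows "integral {0..r} (\<lambda>s. S s x) \<in> D" "A (integral {0..r} (\<lambda>s. S s x)) = S r x - x"
proof -
  define G where "G t = integral {0..t} (\<lambda>s. S s x)" for t
  have int: "(\<lambda>s. S s x) integrable_on {a..b}" if "0 \<le> a" for a b
    using that by (intro integrable_continuous_real continuous_on_subset[OF cont]) auto
  have der: "((\<lambda>h. (G (t + h) - G t) /\<^sub>R h) \<longlongrightarrow> S t x) (at_right 0)" if "0 \<le> t" for t
  proof (rule has_vector_derivative_imp_right_quotient)
    have "(G has_vector_derivative S t x) (at t within {0..t + 1})"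
      unfolding G_def using that
      by (intro integral_has_vector_derivative continuous_on_subset[OF cont]) auto
    then show "(G has_vector_derivative S t x) (at t within {t..t + 1})"
      by (rule has_vector_derivative_within_subset) (use that in auto)
  qed simp
  \<comment> \<open>The bounded operator \<open>S h\<close> moves under the integral, where the
    semigroup law makes it a time shift.\<close>
  have shift: "S h (G r) = G (r + h) - G h" if "0 \<le> h" for h
  proof -
    have "S h (G r) = integral {0..r} (\<lambda>s. S h (S s x))"
      unfolding G_def using integral_linear[OF int blinfun.bounded_linear_right, of 0 r "S h"]
      by (simp add: o_def)
    also have "\<dots> = integral {0..r} (\<lambda>s. S (s + h) x)"
      using S that unfolding C0_semigroup_def
      by (intro integral_cong) (metis add.commute atLeastAtMost_iff blinfun_apply_blinfun_compose)
    also have "\<dots> = integral {h..r + h} (\<lambda>s. S s x)"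
      using integral_shift_Icc_real[of 0 r "\<lambda>s. S s x" h] by (simp add: o_def add.commute)
    also have "\<dots> = G (r + h) - G h"
      using Henstock_Kurzweil_Integration.integral_combine[OF that _ int, of "r + h"] r
      by (simp add: G_def algebra_simps)
    finally show ?thesis .
  qed
  have G0: "G 0 = 0" by (simp add: G_def)
  have "((\<lambda>h. (G (r + h) - G r) /\<^sub>R h - (G (0 + h) - G 0) /\<^sub>R h) \<longlongrightarrow> S r x - S 0 x) (at_right 0)"
    using r by (intro tendsto_diff der) auto
  moreover have "\<forall>\<^sub>F h in at_right 0.
      (G (r + h) - G r) /\<^sub>R h - (G (0 + h) - G 0) /\<^sub>R h = (S h (G r) - G r) /\<^sub>R h"
    unfolding eventually_at_right_field
    by (intro exI[of _ 1]) (auto simp: shift G0 algebra_simps)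
  moreover have "S 0 x = x" using S by (simp add: C0_semigroup_def)
  ultimately have lim: "((\<lambda>h. (S h (G r) - G r) /\<^sub>R h) \<longlongrightarrow> S r x - x) (at_right 0)"
    using tendsto_cong by fastforce
  then have D: "G r \<in> D" using gen by (auto simp: is_generator_def)
  then have "((\<lambda>h. (S h (G r) - G r) /\<^sub>R h) \<longlongrightarrow> A (G r)) (at_right 0)"
    using gen by (auto simp: is_generator_def)
  then have "A (G r) = S r x - x"
    by (rule tendsto_unique[OF _ _ lim, rotated]) simp
  with D show "integral {0..r} (\<lambda>s. S s x) \<in> D" "A (integral {0..r} (\<lambda>s. S s x)) = S r x - x"
    by (simp_all add: G_def)
qed

lemma generator_dom_scaleR:
  assumes gen: "is_generator S D A" and x: "x \<in> D"
  shows "c *\<^sub>R x \<in> D"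
proof -
  have "((\<lambda>t. (S t x - x) /\<^sub>R t) \<longlongrightarrow> A x) (at_right 0)"
    using assms by (auto simp: is_generator_def)
  then have "((\<lambda>t. c *\<^sub>R ((S t x - x) /\<^sub>R t)) \<longlongrightarrow> c *\<^sub>R A x) (at_right 0)"
    by (intro tendsto_intros)
  then have "((\<lambda>t. (S t (c *\<^sub>R x) - c *\<^sub>R x) /\<^sub>R t) \<longlongrightarrow> c *\<^sub>R A x) (at_right 0)"
    by (simp add: blinfun.scaleR_right scaleR_diff_right mult.commute)
  then show ?thesis using gen by (auto simp: is_generator_def)
qed

text \<open>The averages of \<open>S s x\<close> over [0, h] lie in the domain and tend to
  \<open>x\<close> as h decreases to 0.\<close>

lemma generator_densely_defined:
  fixes S :: "real \<Rightarrow> 'h::banach \<Rightarrow>\<^sub>L 'h"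
  assumes S: "C0_semigroup S" and cont: "\<And>x. continuous_on {0..} (\<lambda>t. S t x)"
    and gen: "is_generator S D A"
  shows "closure D = UNIV"
proof -
  have "x \<in> closure D" for x
  proof (rule Lim_in_closed_set[OF closed_closure])
    let ?G = "\<lambda>t. integral {0..t} (\<lambda>s. S s x)"
    have "(?G has_vector_derivative S 0 x) (at 0 within {0..1})"
      by (intro integral_has_vector_derivative continuous_on_subset[OF cont]) auto
    then show "((\<lambda>h. ?G h /\<^sub>R h) \<longlongrightarrow> x) (at_right 0)"
      using has_vector_derivative_imp_right_quotient[of ?G _ 0 1] S
      by (simp add: C0_semigroup_def)
    show "\<forall>\<^sub>F h in at_right 0. ?G h /\<^sub>R h \<in> closure D"
      unfolding eventually_at_right_field
      by (intro exI[of _ 1]) (auto intro!: closure_subset[THEN subsetD] generator_dom_scaleR[OF gen]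
          generator_integral(1)[OF S cont gen])
  qed simp
  then show ?thesis by auto
qed

text \<open>Density of the domain makes the vector in the description operator of
  \<open>adjoint_op\<close> unique, so that its defining equation may be used.\<close>

lemma adjoint_op_works:
  assumes dense: "closure D = UNIV" and y: "y \<in> adjoint_dom D A" and x: "x \<in> D"
  shows "A x \<bullet> y = x \<bullet> adjoint_op D A y"
proof -
  obtain z where z: "\<forall>x\<in>D. A x \<bullet> y = x \<bullet> z" using y by (auto simp: adjoint_dom_def)
  have "adjoint_op D A y = z"
    unfolding adjoint_op_def
  proof (rule the_equality)
    fix z' assume z': "\<forall>x\<in>D. A x \<bullet> y = x \<bullet> z'"
    \<comment> \<open>The functional vanishes on \<open>D\<close>, hence by continuity everywhere,
      and in particular at \<open>z' - z\<close> itself.\<close>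
    have "u \<bullet> (z' - z) = 0" for u
    proof (rule continuous_constant_on_closure[of D "\<lambda>u. u \<bullet> (z' - z)"])
      show "u \<in> closure D" using dense by simp
      show "v \<bullet> (z' - z) = 0" if "v \<in> D" for v
        using z z' that by (simp add: inner_diff_right)
    qed (intro continuous_intros)
    from this[of "z' - z"] show "z' = z" by simp
  qed (fact z)
  with z x show ?thesis by simp
qed

text \<open>With phi(r) = \<open>S r x \<bullet> y\<close>, the integrated evolution equation
  becomes phi(r) = phi(0) + \<alpha> * (integral of phi over [0, r]), whose solution is exponential.
  Arguing through the integral covers all \<open>x\<close>, not only those in
  \<open>D\<close>.\<close>

lemma semigroup_adjoint_eigenvector:
  fixes S :: "real \<Rightarrow> 'h::{real_inner, banach} \<Rightarrow>\<^sub>L 'h"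
  assumes S: "C0_semigroup S" and cont: "\<And>x. continuous_on {0..} (\<lambda>t. S t x)"
    and gen: "is_generator S D A" and eig: "\<And>x. x \<in> D \<Longrightarrow> A x \<bullet> y = \<alpha> * (x \<bullet> y)"
    and t: "0 \<le> t"
  shows "S t x \<bullet> y = exp (\<alpha> * t) * (x \<bullet> y)"
proof -
  let ?G = "\<lambda>r. integral {0..r} (\<lambda>s. S s x)"
  have repr: "S r x \<bullet> y = x \<bullet> y + \<alpha> * (?G r \<bullet> y)" if "0 \<le> r" for r
    using eig[OF generator_integral(1)[OF S cont gen that]]
      generator_integral(2)[OF S cont gen that]
    by (simp add: inner_diff_left diff_eq_eq add.commute)
  \<comment> \<open>With the integrating factor the derivative cancels by \<open>repr\<close>, so
    the product keeps its value at 0.\<close>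
  have "\<exists>c. \<forall>r\<in>{0..t}. exp (- \<alpha> * r) * (x \<bullet> y + \<alpha> * (?G r \<bullet> y)) = c"
  proof (rule has_field_derivative_zero_constant)
    fix r assume r: "r \<in> {0..t}"
    have "(?G has_vector_derivative S r x) (at r within {0..t})"
      using r by (intro integral_has_vector_derivative continuous_on_subset[OF cont]) auto
    then have "((\<lambda>r. ?G r \<bullet> y) has_field_derivative S r x \<bullet> y) (at r within {0..t})"
      using bounded_linear.has_vector_derivative[OF bounded_linear_inner_left]
      by (simp add: has_real_derivative_iff_has_vector_derivative)
    note [derivative_intros] = this
    show "((\<lambda>r. exp (- \<alpha> * r) * (x \<bullet> y + \<alpha> * (?G r \<bullet> y))) has_field_derivative 0)
        (at r within {0..t})"
      using r by (auto intro!: derivative_eq_intros simp: repr)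
  qed simp
  then have "exp (- \<alpha> * t) * (x \<bullet> y + \<alpha> * (?G t \<bullet> y)) =
      exp (- \<alpha> * 0) * (x \<bullet> y + \<alpha> * (?G 0 \<bullet> y))"
    using t by (metis atLeastAtMost_iff order_refl)
  then have "exp (- \<alpha> * t) * (S t x \<bullet> y) = exp (- \<alpha> * 0) * (S 0 x \<bullet> y)"
    unfolding repr[OF t] repr[OF order_refl] .
  moreover have "S 0 x = x" using S by (simp add: C0_semigroup_def)
  ultimately show ?thesis by (simp add: exp_minus field_simps)
qed

section \<open>Ito integrals have mean zero\<close>

text \<open>Preimages under \<open>g\<close> belong to \<open>G\<close>, so independence of the
  sigma-algebra \<open>G\<close> passes to the variable \<open>g\<close>, and expectations of
  products factor.\<close>

lemma (in prob_space) indep_subalgebra_mult: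
  fixes X g :: "'a \<Rightarrow> real"
  assumes G: "subalgebra M G" and X: "integrable M X"
    and g: "g \<in> borel_measurable G" "integrable M g"
    and indep: "indep_set (sets G) {X -` B \<inter> space M | B. B \<in> sets borel}"
  shows "integrable M (\<lambda>\<omega>. X \<omega> * g \<omega>)"
    and "expectation (\<lambda>\<omega>. X \<omega> * g \<omega>) = expectation X * expectation g"
proof -
  have "{g -` B \<inter> space M | B. B \<in> sets borel} \<subseteq> sets G"
    using g(1) G by (auto simp: subalgebra_def dest: measurable_sets)
  then have "indep_sets (\<lambda>i. {case_bool g X i -` B \<inter> space M | B. B \<in> sets (case_bool borel borel i)}) UNIV"
    by (intro indep_sets_mono_sets[OF indep[unfolded indep_set_def]]) (simp split: bool.split)
  then have "indep_var borel g borel X"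
    unfolding indep_var_def indep_vars_def2 using X g(2) by (simp split: bool.split)
  then show "integrable M (\<lambda>\<omega>. X \<omega> * g \<omega>)"
    and "expectation (\<lambda>\<omega>. X \<omega> * g \<omega>) = expectation X * expectation g"
    using indep_var_integrable[of g X] indep_var_lebesgue_integral[of g X] X g
    by (simp_all add: mult.commute)
qed

text \<open>The increment is a centred Gaussian independent of the past, to which \<open>g\<close>
  belongs. The case \<open>s = t\<close> is split off because the normal law is prescribed only for
  strictly later times; there the increment is 0.\<close>

lemma (in prob_space) brownian_increment_mult:
  assumes b: "brownian_motion M F b" and F: "subalgebra M (F s)" and st: "0 \<le> s" "s \<le> t"
    and g: "g \<in> borel_measurable (F s)" "bounded (g ` space (F s))"
  shows "integrable M (\<lambda>\<omega>. (b t \<omega> - b s \<omega>) * g \<omega>)"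
    and "expectation (\<lambda>\<omega>. (b t \<omega> - b s \<omega>) * g \<omega>) = 0"
proof -
  have "integrable M (\<lambda>\<omega>. (b t \<omega> - b s \<omega>) * g \<omega>) \<and>
    expectation (\<lambda>\<omega>. (b t \<omega> - b s \<omega>) * g \<omega>) = 0"
  proof (cases "s = t")
    case False
    with st have "s < t" by simp
    then have dist: "distributed M lborel (\<lambda>\<omega>. b t \<omega> - b s \<omega>) (normal_density 0 (sqrt (t - s)))"
      and indep: "indep_set (sets (F s)) {(\<lambda>\<omega>. b t \<omega> - b s \<omega>) -` B \<inter> space M | B. B \<in> sets borel}"
      using b st unfolding brownian_motion_def by blast+
    have "expectation (\<lambda>\<omega>. b t \<omega> - b s \<omega>) = 0"
      using \<open>s < t\<close> by (intro normal_distributed_expectation[OF _ dist]) simp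
    moreover have "integrable M (\<lambda>\<omega>. b t \<omega> - b s \<omega>)"
      using \<open>s < t\<close> integrable_normal_moment_nz_1[of "sqrt (t - s)" 0]
      by (subst distributed_integrable[OF dist, of "\<lambda>x. x", symmetric]) auto
    moreover obtain K where "\<And>\<omega>. \<omega> \<in> space M \<Longrightarrow> norm (g \<omega>) \<le> K"
      using g(2) F by (auto simp: bounded_iff subalgebra_def)
    then have "integrable M g"
      using measurable_from_subalg[OF F g(1)] by (intro integrable_const_bound[of _ K]) auto
    ultimately show ?thesis
      using indep_subalgebra_mult[OF F _ g(1) _ indep] by simp
  qed simp
  then show "integrable M (\<lambda>\<omega>. (b t \<omega> - b s \<omega>) * g \<omega>)"
    and "expectation (\<lambda>\<omega>. (b t \<omega> - b s \<omega>) * g \<omega>) = 0" by auto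
qed

text \<open>\<open>cylindrical_wiener\<close> prescribes Brownian motions in unit directions only.
  Almost sure linearity reduces \<open>k\<close> to its normalization \<open>l\<close>.\<close>

lemma (in prob_space) wiener_increment_mult:
  assumes W: "cylindrical_wiener M F W" and F: "\<And>t. 0 \<le> t \<Longrightarrow> subalgebra M (F t)"
    and st: "0 \<le> s" "s \<le> t"
    and g: "g \<in> borel_measurable (F s)" "bounded (g ` space (F s))"
  shows "integrable M (\<lambda>\<omega>. (W t k \<omega> - W s k \<omega>) * g \<omega>)"
    and "expectation (\<lambda>\<omega>. (W t k \<omega> - W s k \<omega>) * g \<omega>) = 0"
proof -
  have meas: "W r l \<in> borel_measurable M" if "0 \<le> r" for r l
    using W that measurable_from_subalg[OF F[OF that]] unfolding cylindrical_wiener_def by blast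
  note [measurable] = meas[OF st(1)] meas[OF order_trans[OF st]] measurable_from_subalg[OF F[OF st(1)] g(1)]
  define l where "l = k /\<^sub>R norm k"
  have scale: "AE \<omega> in M. W r k \<omega> = norm k * W r l \<omega>" if "0 \<le> r" for r
  proof -
    \<comment> \<open>Homogeneity is the two-term linearity clause with second coefficient 0. For
      \<open>k = 0\<close> the inverse of 0 is 0, so \<open>l = 0\<close> and the identity
      persists.\<close>
    have "AE \<omega> in M. W r (norm k *\<^sub>R l + 0 *\<^sub>R l) \<omega> = norm k * W r l \<omega> + 0 * W r l \<omega>"
      using W that unfolding cylindrical_wiener_def by blast
    moreover have "norm k *\<^sub>R l + 0 *\<^sub>R l = k" by (cases "k = 0") (simp_all add: l_def)
    ultimately show ?thesis by simp
  qed
  have ae: "AE \<omega> in M. (W t k \<omega> - W s k \<omega>) * g \<omega> = norm k * ((W t l \<omega> - W s l \<omega>) * g \<omega>)"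
    using scale[OF st(1)] scale[OF order_trans[OF st]]
    by eventually_elim (simp add: algebra_simps)
  have "integrable M (\<lambda>\<omega>. norm k * ((W t l \<omega> - W s l \<omega>) * g \<omega>)) \<and>
    expectation (\<lambda>\<omega>. norm k * ((W t l \<omega> - W s l \<omega>) * g \<omega>)) = 0"
  proof (cases "k = 0")
    case False
    then have "brownian_motion M F (\<lambda>t. W t l)"
      using W by (simp add: cylindrical_wiener_def l_def)
    from brownian_increment_mult[OF this F[OF st(1)] st g] show ?thesis by simp
  qed simp
  then show "integrable M (\<lambda>\<omega>. (W t k \<omega> - W s k \<omega>) * g \<omega>)"
    and "expectation (\<lambda>\<omega>. (W t k \<omega> - W s k \<omega>) * g \<omega>) = 0"
    using integrable_cong_AE[OF _ _ ae] integral_cong_AE[OF _ _ ae] by simp_all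
qed

text \<open>Each summand pairs an increment after time \<open>a\<close> with a bounded weight known
  at time \<open>a\<close>. The summands have mean zero separately, so overlapping intervals do no
  harm.\<close>

lemma (in prob_space) elementary_integral_mean_zero:
  assumes W: "cylindrical_wiener M F W" and F: "\<And>t. 0 \<le> t \<Longrightarrow> subalgebra M (F t)"
    and es: "elementary_on F T es"
  shows "integrable M (\<lambda>\<omega>. elementary_integral W es \<omega> \<bullet> v) \<and>
    expectation (\<lambda>\<omega>. elementary_integral W es \<omega> \<bullet> v) = 0"
  using es
proof (induction es)
  case Nil
  then show ?case by (simp add: elementary_integral_def)
next
  case (Cons e es)
  obtain a b k h where e: "e = (a, b, k, h)" by (cases e) auto
  have ab: "0 \<le> a" "a \<le> b" and h: "h \<in> borel_measurable (F a)" "bounded (h ` space (F a))"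
    using Cons.prems by (auto simp: elementary_on_def e)
  have hv: "(\<lambda>\<omega>. h \<omega> \<bullet> v) \<in> borel_measurable (F a)"
    using h(1) by (rule borel_measurable_inner) simp
  have "bounded ((\<lambda>\<omega>. h \<omega> \<bullet> v) ` space (F a))"
    using bounded_linear_image[OF h(2) bounded_linear_inner_left] by (simp add: image_image)
  from wiener_increment_mult[OF W F ab hv this]
  have "integrable M (\<lambda>\<omega>. (W b k \<omega> - W a k \<omega>) * (h \<omega> \<bullet> v)) \<and>
    expectation (\<lambda>\<omega>. (W b k \<omega> - W a k \<omega>) * (h \<omega> \<bullet> v)) = 0" by blast
  moreover have "elementary_integral W (e # es) \<omega> \<bullet> v =
    (W b k \<omega> - W a k \<omega>) * (h \<omega> \<bullet> v) + elementary_integral W es \<omega> \<bullet> v" for \<omega>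
    by (simp add: elementary_integral_def e inner_add_left)
  moreover have "elementary_on F T es"
    using Cons.prems by (simp add: elementary_on_def)
  ultimately show ?case using Cons.IH by simp
qed

text \<open>On a probability space mean square convergence implies convergence in mean. The
  elementary bound |x| <= d + x^2 / d does the work of the Cauchy-Schwarz inequality and also yields
  integrability of \<open>f\<close>.\<close>

lemma (in prob_space) mean_zero_L2_limit:
  fixes f :: "'a \<Rightarrow> real"
  assumes u: "\<And>n. integrable M (u n)" "\<And>n. expectation (u n) = 0"
    and f: "f \<in> borel_measurable M"
    and lim: "(\<lambda>n. \<integral>\<^sup>+\<omega>. ennreal ((u n \<omega> - f \<omega>)\<^sup>2) \<partial>M) \<longlonglongrightarrow> 0"
  shows "integrable M f" "expectation f = 0"
proof -
  have close: "integrable M f \<and> \<bar>expectation f\<bar> \<le> e" if "0 < e" for e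
  proof -
    \<comment> \<open>Once the mean square error is below d^2, the bound gives d + d^2 / d = 2 * d =
      e.\<close>
    define d where "d = e / 2"
    have d: "0 < d" using that by (simp add: d_def)
    have "\<forall>\<^sub>F n in sequentially. (\<integral>\<^sup>+\<omega>. ennreal ((u n \<omega> - f \<omega>)\<^sup>2) \<partial>M) < ennreal (d\<^sup>2)"
      using d by (intro order_tendstoD[OF lim]) simp
    then obtain n where n: "(\<integral>\<^sup>+\<omega>. ennreal ((u n \<omega> - f \<omega>)\<^sup>2) \<partial>M) < ennreal (d\<^sup>2)"
      by (auto simp: eventually_sequentially)
    note [measurable] = f borel_measurable_integrable[OF u(1)]
    have "\<bar>x\<bar> \<le> d + x\<^sup>2 / d" for x :: real
    proof -
      have "d * \<bar>x\<bar> \<le> d\<^sup>2 + \<bar>x\<bar>\<^sup>2"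
        using sum_squares_bound[of d "\<bar>x\<bar>"] d mult_nonneg_nonneg[of d "\<bar>x\<bar>"] by linarith
      then show ?thesis using d by (simp add: field_simps power2_eq_square)
    qed
    then have "(\<integral>\<^sup>+\<omega>. ennreal \<bar>u n \<omega> - f \<omega>\<bar> \<partial>M) \<le>
        (\<integral>\<^sup>+\<omega>. ennreal d + ennreal (1 / d) * ennreal ((u n \<omega> - f \<omega>)\<^sup>2) \<partial>M)"
      using d by (intro nn_integral_mono) (simp add: ennreal_mult[symmetric] ennreal_plus[symmetric] del: ennreal_plus)
    also have "\<dots> = ennreal d + ennreal (1 / d) * (\<integral>\<^sup>+\<omega>. ennreal ((u n \<omega> - f \<omega>)\<^sup>2) \<partial>M)"
      by (subst nn_integral_add) (simp_all add: nn_integral_cmult emeasure_space_1)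
    also have "\<dots> \<le> ennreal d + ennreal (1 / d) * ennreal (d\<^sup>2)"
      using n by (intro add_left_mono mult_left_mono) auto
    also have "\<dots> = ennreal e"
      using d by (simp add: ennreal_mult[symmetric] ennreal_plus[symmetric] power2_eq_square d_def del: ennreal_plus)
    finally have le: "(\<integral>\<^sup>+\<omega>. ennreal \<bar>u n \<omega> - f \<omega>\<bar> \<partial>M) \<le> ennreal e" .
    have int: "integrable M (\<lambda>\<omega>. u n \<omega> - f \<omega>)"
      using le by (intro integrableI_bounded) (auto simp: le_less_trans)
    then have intf: "integrable M f"
      using Bochner_Integration.integrable_diff[OF u(1)[of n] int] by simp
    have "\<bar>expectation f\<bar> = \<bar>expectation (\<lambda>\<omega>. u n \<omega> - f \<omega>)\<bar>"
      using u[of n] intf by simp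
    also have "\<dots> \<le> expectation (\<lambda>\<omega>. \<bar>u n \<omega> - f \<omega>\<bar>)"
      by (rule integral_abs_bound)
    also have "\<dots> \<le> e"
      using that le by (intro integral_real_bounded) auto
    finally show ?thesis using intf by simp
  qed
  show "integrable M f" using close[of 1] by simp
  show "expectation f = 0"
    using close field_le_epsilon[of "\<bar>expectation f\<bar>" 0] by simp
qed

text \<open>The mean passes from elementary integrals to their mean square limit. Pairing first with
  \<open>sgn v\<close>, of norm at most 1, does not increase mean square errors; the factor
  \<open>norm v\<close> is restored afterwards.\<close>

lemma (in prob_space) stochastic_integral_mean_zero:
  assumes W: "cylindrical_wiener M F W" and F: "\<And>t. 0 \<le> t \<Longrightarrow> subalgebra M (F t)"
    and T: "0 \<le> T" and I: "has_stochastic_integral M F W T \<Phi> I"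
  shows "integrable M (\<lambda>\<omega>. I \<omega> \<bullet> v)" "expectation (\<lambda>\<omega>. I \<omega> \<bullet> v) = 0"
proof -
  obtain es where es: "\<And>n. elementary_on F T (es n)"
    and lim: "(\<lambda>n. \<integral>\<^sup>+\<omega>. ennreal ((norm (elementary_integral W (es n) \<omega> - I \<omega>))\<^sup>2) \<partial>M) \<longlonglongrightarrow> 0"
    using I unfolding has_stochastic_integral_def by blast
  have [measurable]: "I \<in> borel_measurable M"
    using I measurable_from_subalg[OF F[OF T]] unfolding has_stochastic_integral_def by blast
  let ?w = "sgn v"
  let ?u = "\<lambda>n \<omega>. elementary_integral W (es n) \<omega> \<bullet> ?w"
  have u: "integrable M (?u n)" "expectation (?u n) = 0" for n
    using elementary_integral_mean_zero[OF W F es] by auto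
  have "((x - z) \<bullet> ?w)\<^sup>2 \<le> (norm (x - z))\<^sup>2" for x z
  proof -
    have "\<bar>(x - z) \<bullet> ?w\<bar> \<le> norm (x - z) * norm ?w" by (rule Cauchy_Schwarz_ineq2)
    also have "\<dots> \<le> norm (x - z)" by (simp add: norm_sgn)
    finally show ?thesis by (simp add: abs_le_square_iff[symmetric])
  qed
  then have "(\<lambda>n. \<integral>\<^sup>+\<omega>. ennreal ((?u n \<omega> - I \<omega> \<bullet> ?w)\<^sup>2) \<partial>M) \<longlonglongrightarrow> 0"
    by (intro tendsto_sandwich[OF _ _ tendsto_const lim] always_eventually allI nn_integral_mono)
       (simp_all add: inner_diff_left)
  note I_sgn = mean_zero_L2_limit[OF u _ this]
  have "I \<omega> \<bullet> v = norm v * (I \<omega> \<bullet> ?w)" for \<omega>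
    by (cases "v = 0") (simp_all add: sgn_div_norm)
  then have eq: "(\<lambda>\<omega>. I \<omega> \<bullet> v) = (\<lambda>\<omega>. norm v * (I \<omega> \<bullet> ?w))"
    by blast
  show "integrable M (\<lambda>\<omega>. I \<omega> \<bullet> v)"
    unfolding eq by (intro integrable_mult_right impI I_sgn(1)) measurable
  have "expectation (\<lambda>\<omega>. I \<omega> \<bullet> ?w) = 0"
    by (rule I_sgn(2)) measurable
  then show "expectation (\<lambda>\<omega>. I \<omega> \<bullet> v) = 0"
    unfolding eq integral_mult_right_zero by (simp only: mult_zero_right)
qed

section \<open>The vanishing drift and the contradiction\<close>

text \<open>If \<open>f\<close> is not integrable, its integral is 0 by convention and the claim
  still holds. The drift can therefore be treated for every path of the control without an
  integrability check.\<close>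

lemma set_integral_inner_zero:
  fixes f :: "real \<Rightarrow> 'h::{real_inner, banach, second_countable_topology}"
  assumes "\<And>s. s \<in> A \<Longrightarrow> f s \<bullet> y = 0"
  shows "(LBINT s:A. f s) \<bullet> y = 0"
proof (cases "set_integrable lborel A f")
  case True
  have "(LBINT s:A. f s) \<bullet> y = (LINT s|lborel. (indicator A s *\<^sub>R f s) \<bullet> y)"
    using True unfolding set_lebesgue_integral_def set_integrable_def
    by (intro integral_inner_left[symmetric])
  also have "\<dots> = (LINT (s::real)|lborel. 0)"
    using assms by (intro Bochner_Integration.integral_cong) (auto simp: indicator_def)
  finally show ?thesis by simp
next
  case False
  then show ?thesis
    by (simp add: set_lebesgue_integral_def set_integrable_def not_integrable_integral_eq)
qed

theorem proposition4:
  fixes M :: "'w measure" and F :: "real \<Rightarrow> 'w measure"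
    and W :: "real \<Rightarrow> 'k::separable_hilbert_space \<Rightarrow> 'w \<Rightarrow> real"
    and S :: "real \<Rightarrow> 'h::separable_hilbert_space \<Rightarrow>\<^sub>L 'h"
    and DA :: "'h set" and A :: "'h \<Rightarrow> 'h"
    and B :: "'u::separable_hilbert_space \<Rightarrow>\<^sub>L 'h"
    and DC D1 :: "'h set" and C C1 :: "'h \<Rightarrow> 'k \<Rightarrow>\<^sub>L 'h"
    and C2 :: "'h \<Rightarrow>\<^sub>L ('k, 'h) hs"
  assumes basis: "stochastic_basis M F"
    and wiener: "cylindrical_wiener M F W"
    and semigroup: "C0_semigroup S" "is_generator S DA A" "dissipative DA A"
    and noise: "admissible_noise S DC C"
    and A1: "assumption_A1 S DA A DC C D1 C1 C2"
    and A2: "assumption_A2 DA A D1 C1"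
    and A3: "exponentially_stable S"
    and C1_hs: "\<forall>x\<in>D1. hilbert_schmidt (C1 x)"
    and controllable: "approximately_controllable M F W S B DC C"
  shows "\<forall>y\<in>adjoint_dom DA A. \<forall>\<alpha><0. y \<noteq> 0 \<longrightarrow>
    norm (adjoint (blinfun_apply B) y) + norm (adjoint_op DA A y - \<alpha> *\<^sub>R y) > 0"
proof (intro ballI allI impI, rule ccontr)
  fix y \<alpha>
  assume y: "y \<in> adjoint_dom DA A" "y \<noteq> 0"
    and "\<not> norm (adjoint (blinfun_apply B) y) + norm (adjoint_op DA A y - \<alpha> *\<^sub>R y) > 0"
  then have "norm (adjoint (blinfun_apply B) y) = 0" "norm (adjoint_op DA A y - \<alpha> *\<^sub>R y) = 0"
    using norm_ge_zero[of "adjoint (blinfun_apply B) y"]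
      norm_ge_zero[of "adjoint_op DA A y - \<alpha> *\<^sub>R y"] by linarith+
  then have By: "adjoint (blinfun_apply B) y = 0" and Ay: "adjoint_op DA A y = \<alpha> *\<^sub>R y"
    by simp_all
  interpret prob_space M using basis by (simp add: stochastic_basis_def)
  have F: "subalgebra M (F t)" if "0 \<le> t" for t
    using basis that by (simp add: stochastic_basis_def)
  obtain K \<omega> where K: "0 < K" "0 < \<omega>" "\<And>t. 0 \<le> t \<Longrightarrow> norm (S t) \<le> K * exp (- \<omega> * t)"
    using A3 by (auto simp: exponentially_stable_def)
  \<comment> \<open>Exponential stability enters through this uniform bound, which makes the orbits
    continuous.\<close>
  have "norm (S t) \<le> K" if "0 \<le> t" for t
  proof -
    have "K * exp (- \<omega> * t) \<le> K * 1" using K that by (intro mult_left_mono) auto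
    with K(3)[OF that] show ?thesis by simp
  qed
  then have cont: "continuous_on {0..} (\<lambda>t. S t x)" for x
    by (rule C0_semigroup_continuous_on[OF semigroup(1)])
  have eig: "A x \<bullet> y = \<alpha> * (x \<bullet> y)" if "x \<in> DA" for x
    using adjoint_op_works[OF generator_densely_defined[OF semigroup(1) cont semigroup(2)] y(1) that]
    by (simp add: Ay)
  \<comment> \<open>The pairing is \<open>exp (\<alpha> * t)\<close> times
    \<open>B u \<bullet> y\<close>, and the latter equals \<open>u\<close> paired with the adjoint
    of \<open>B\<close> at \<open>y\<close>, which is 0.\<close>
  have drift: "S t (B u) \<bullet> y = 0" if "0 \<le> t" for t u
    using semigroup_adjoint_eigenvector[OF semigroup(1) cont semigroup(2) eig that]
    by (simp add: adjoint_blinfun By)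
  \<comment> \<open>Controllability is tested with initial state 0, time 1, the constant target
    \<open>y\<close> and tolerance half of \<open>y \<bullet> y\<close>; the error will turn out to
    be at least \<open>y \<bullet> y\<close>.\<close>
  have "(\<lambda>_. y) \<in> borel_measurable (F 1)" "(\<integral>\<^sup>+\<omega>. ennreal ((norm y)\<^sup>2) \<partial>M) < \<infinity>"
    "0 < (y \<bullet> y) / 2"
    using y(2) by (simp_all add: emeasure_space_1)
  then obtain u X where X: "mild_solution M F W S B DC C 0 u X"
    and le: "(\<integral>\<^sup>+\<omega>. ennreal ((norm (X 1 \<omega> - y))\<^sup>2) \<partial>M) \<le> ennreal ((y \<bullet> y) / 2)"
    using controllable zero_less_one unfolding approximately_controllable_def by blast
  obtain I where I: "has_stochastic_integral M F W 1
      (\<lambda>s \<omega>. if s < 1 then semigroup_noise S DC C (1 - s) (X s \<omega>) else 0) I"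
    and X1: "AE \<omega> in M. X 1 \<omega> = S 1 0 + (LBINT s:{0..1}. S (1 - s) (B (u s \<omega>))) + I \<omega>"
    using X zero_less_one unfolding mild_solution_def by blast
  note mean = stochastic_integral_mean_zero[OF wiener F zero_le_one I, of y]
  have drift_integral: "(LBINT s:{0..1}. S (1 - s) (B (u s \<omega>))) \<bullet> y = 0" for \<omega>
    by (rule set_integral_inner_zero) (simp add: drift)
  have X1_y: "AE \<omega> in M. X 1 \<omega> \<bullet> y = I \<omega> \<bullet> y"
    using X1 by eventually_elim (simp add: inner_add_left drift_integral)
  \<comment> \<open>Dropping the square of \<open>norm x\<close> leaves an expression affine in
    \<open>x \<bullet> y\<close>, the only quantity whose mean is known.\<close>
  have le_norm: "y \<bullet> y - 2 * (x \<bullet> y) \<le> (norm (x - y))\<^sup>2" for x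
    by (simp add: power2_norm_eq_inner inner_diff_left inner_diff_right inner_commute)
  have "AE \<omega> in M. ennreal (y \<bullet> y - 2 * (I \<omega> \<bullet> y)) \<le> ennreal ((norm (X 1 \<omega> - y))\<^sup>2)"
    using X1_y by eventually_elim (metis ennreal_leI le_norm)
  then have "(\<integral>\<^sup>+\<omega>. ennreal (y \<bullet> y - 2 * (I \<omega> \<bullet> y)) \<partial>M) \<le>
      (\<integral>\<^sup>+\<omega>. ennreal ((norm (X 1 \<omega> - y))\<^sup>2) \<partial>M)"
    by (rule nn_integral_mono_AE)
  \<comment> \<open>The integrand may be negative, where \<open>ennreal\<close> gives 0; the
    nonnegative integral still bounds the expectation from above.\<close>
  then have "expectation (\<lambda>\<omega>. y \<bullet> y - 2 * (I \<omega> \<bullet> y)) \<le> (y \<bullet> y) / 2"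
    using le by (intro integral_real_bounded) auto
  moreover have "expectation (\<lambda>\<omega>. y \<bullet> y - 2 * (I \<omega> \<bullet> y)) = y \<bullet> y"
    using mean by (simp add: prob_space)
  ultimately show False using y(2) by simp
qed

end
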